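(* Let $k\ge 2$ be an integer, let $K:[0,1]^2\to(0,\infty)$ be continuous, and put $M=\max_{(t,u)\in[0,1]^2}K(t,u)$, $m=\min_{(t,u)\in[0,1]^2}K(t,u)$. If $$\left(\frac{M}{m}\right)^k-\left(\frac{m}{M}\right)^k<\frac1k,$$ then the system of equations $$f(t)=\left(\frac{\int_0^1K(t,u)g(u)\,du}{\int_0^1K(0,u)g(u)\,du}\right)^k,\qquad g(t)=\left(\frac{\int_0^1K(t,u)f(u)\,du}{\int_0^1K(0,u)f(u)\,du}\right)^k,\qquad t\in[0,1],$$ has no solution $(f,g)\in(C_0^+[0,1])^2$ with $f\neq g$.
   Context: $C_0^+[0,1]$ is the set of continuous functions $\varphi:[0,1]\to[0,\infty)$ that are not identically zero. *)

theory Defs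
  imports "HOL-Analysis.Analysis"
begin

text \<open>Functions on \<open>[0,1]\<close> are represented by total functions on the reals of which only the
  values on \<open>{0..1}\<close> matter; so two of them are equal iff they agree on \<open>{0..1}\<close>.\<close>

definition C0_plus :: "(real \<Rightarrow> real) set" where
  "C0_plus = {\<phi>. continuous_on {0..1} \<phi> \<and> (\<forall>t\<in>{0..1}. 0 \<le> \<phi> t) \<and> (\<exists>t\<in>{0..1}. \<phi> t \<noteq> 0)}"

definition is_max_on :: "('a \<Rightarrow> real) \<Rightarrow> 'a set \<Rightarrow> real \<Rightarrow> bool" where
  "is_max_on h S y \<longleftrightarrow> y \<in> h ` S \<and> (\<forall>p\<in>S. h p \<le> y)"

definition is_min_on :: "('a \<Rightarrow> real) \<Rightarrow> 'a set \<Rightarrow> real \<Rightarrow> bool" where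
  "is_min_on h S y \<longleftrightarrow> y \<in> h ` S \<and> (\<forall>p\<in>S. y \<le> h p)"

end

theory Submission
  imports Defs
begin

text \<open>A solution consists of functions that are at least \<open>(m / M) ^ k\<close>, and the quotient
  \<open>\<integral> K(t,u) \<phi>(u) du / \<integral> K(0,u) \<phi>(u) du\<close> is Lipschitz in \<open>\<phi>\<close> for the sup norm on such functions:
  if \<open>v\<close> is its value at \<open>f\<close>, then its value at \<open>g\<close> differs from \<open>v\<close> by
  \<open>\<integral> (K(t,u) - v K(0,u)) (g(u) - f(u)) du / \<integral> K(0,u) g(u) du\<close>. With \<open>q = M / m\<close>, this gives
  \<open>\<parallel>f - g\<parallel> \<le> k q\<^sup>2\<^sup>k (q - 1 / q) \<parallel>f - g\<parallel>\<close>, and the hypothesis on \<open>q\<close> makes the factor less than 1.\<close>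

lemma abs_power_diff_le:
  fixes x y B :: real
  assumes "\<bar>x\<bar> \<le> B" "\<bar>y\<bar> \<le> B"
  shows "\<bar>x ^ n - y ^ n\<bar> \<le> real n * B ^ (n - 1) * \<bar>x - y\<bar>"
proof (induction n)
  case 0
  then show ?case by simp
next
  case (Suc n)
  have B: "0 \<le> B" using assms by linarith
  have "x ^ Suc n - y ^ Suc n = x * (x ^ n - y ^ n) + (x - y) * y ^ n"
    by (simp add: algebra_simps)
  then have "\<bar>x ^ Suc n - y ^ Suc n\<bar> \<le> \<bar>x\<bar> * \<bar>x ^ n - y ^ n\<bar> + \<bar>x - y\<bar> * \<bar>y\<bar> ^ n"
    using abs_triangle_ineq[of "x * (x ^ n - y ^ n)" "(x - y) * y ^ n"]
    by (simp add: abs_mult power_abs)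
  also have "\<dots> \<le> B * (real n * B ^ (n - 1) * \<bar>x - y\<bar>) + \<bar>x - y\<bar> * B ^ n"
    using assms B Suc by (intro add_mono mult_mono power_mono) auto
  \<comment> \<open>The case split handles the truncated exponent \<open>n - 1\<close>:
    \<open>B * B ^ (n - 1)\<close> is \<open>B ^ n\<close> only for positive \<open>n\<close>, and
    for \<open>n = 0\<close> the factor \<open>real n\<close> removes that term.\<close>
  also have "\<dots> = real (Suc n) * B ^ (Suc n - 1) * \<bar>x - y\<bar>"
    by (cases n) (auto simp: algebra_simps)
  finally show ?case .
qed

text \<open>With q = exp s this is n sinh s \<le> sinh (n s) for s \<ge> 0: the map x - 1/x is
  superadditive under multiplication of arguments that are at least 1. It turns the hypothesis on
  k-th powers into a bound on \<open>q - 1 / q\<close> with the factor k that the contraction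
  constant carries.\<close>

lemma mult_diff_inverse_le_power_diff:
  fixes q :: real
  assumes "1 \<le> q"
  shows "real n * (q - 1 / q) \<le> q ^ n - (1 / q) ^ n"
proof (induction n)
  case 0
  then show ?case by simp
next
  case (Suc n)
  define p where "p = q ^ n"
  have p: "1 \<le> p" using assms by (simp add: p_def)
  have "1 \<le> q * p" using mult_mono[of 1 q 1 p] assms p by simp
  \<comment> \<open>This product is exactly the surplus in the superadditivity inequality, in
    factored form.\<close>
  then have "0 \<le> (q - 1) * ((p - 1) * (1 - 1 / (q * p)))"
    using assms p by (intro mult_nonneg_nonneg) auto
  also have "\<dots> = (q * p - 1 / (q * p)) - (p - 1 / p) - (q - 1 / q)"
    using assms p by (simp add: field_simps)
  finally have "(p - 1 / p) + (q - 1 / q) \<le> q * p - 1 / (q * p)" by simp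
  then show ?case using Suc by (simp add: p_def power_one_over algebra_simps)
qed

text \<open>With p = q^k the factor equals p^2 * k (q - 1/q), which is at most p^2 (p - 1/p) and
  hence at most p^2 / k. Since k \<ge> 2, the hypothesis also keeps p so close to 1 that p^2 < 2,
  and 2 / k \<le> 1.\<close>

lemma contraction_factor_less_1:
  fixes q :: real
  assumes "2 \<le> k" "1 \<le> q" "q ^ k - (1 / q) ^ k < 1 / real k"
  shows "real k * q ^ (k - 1) * ((q\<^sup>2 - 1) * q ^ k) < 1"
proof -
  define p where "p = q ^ k"
  have p: "1 \<le> p" using assms by (simp add: p_def)
  have d: "p - 1 / p < 1 / real k" using assms(3) by (simp add: p_def power_one_over)
  have "1 / real k \<le> 1 / 2" using assms(1) by (simp add: field_simps)
  then have "p - 1 / p < 1 / 2" using d by linarith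
  then have "p * p - 1 < p / 2" using p by (simp add: field_simps)
  \<comment> \<open>The positive root of p^2 - p/2 - 1 is (1 + sqrt 17) / 4, about 1.28; 4/3 is a
    convenient rational between it and sqrt 2. The product expands to p^2 - p/2 - 10/9.\<close>
  then have "(p - 4 / 3) * (p + 5 / 6) < 0" by (simp add: algebra_simps)
  then have "p < 4 / 3" using p by (simp add: mult_less_0_iff)
  then have "p * p < (4 / 3) * (4 / 3)" using p by (intro mult_strict_mono) auto
  then have p2: "p * p < 2" by simp
  have "q ^ (k - 1) * (q\<^sup>2 - 1) = p * (q - 1 / q)"
    using assms(1,2) by (cases k) (auto simp: p_def field_simps power2_eq_square)
  then have "real k * q ^ (k - 1) * ((q\<^sup>2 - 1) * q ^ k) = p * p * (real k * (q - 1 / q))"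
    unfolding p_def[symmetric] by (metis mult.assoc mult.commute)
  also have "\<dots> \<le> p * p * (p - 1 / p)"
    using mult_diff_inverse_le_power_diff[OF assms(2), of k] p
    by (intro mult_left_mono) (auto simp: p_def power_one_over)
  also have "\<dots> \<le> p * p * (1 / real k)"
    using d p by (intro mult_left_mono) auto
  also have "\<dots> < 2 * (1 / real k)"
    using p2 assms(1) by (intro mult_strict_right_mono) auto
  also have "\<dots> \<le> 1" using assms(1) by simp
  finally show ?thesis .
qed

lemma weighted_integral_bounds:
  fixes a \<phi> :: "real \<Rightarrow> real"
  assumes "continuous_on {0..1} a" "continuous_on {0..1} \<phi>"
    and "\<And>u. u \<in> {0..1} \<Longrightarrow> m \<le> a u \<and> a u \<le> M" "\<And>u. u \<in> {0..1} \<Longrightarrow> 0 \<le> \<phi> u"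
  shows "m * integral {0..1} \<phi> \<le> integral {0..1} (\<lambda>u. a u * \<phi> u)"
    and "integral {0..1} (\<lambda>u. a u * \<phi> u) \<le> M * integral {0..1} \<phi>"
proof -
  have i: "(\<lambda>u. a u * \<phi> u) integrable_on {0..1}" "(\<lambda>u. c * \<phi> u) integrable_on {0..1}" for c
    using assms(1,2) by (auto intro!: integrable_continuous_interval continuous_on_mult continuous_on_const)
  have "integral {0..1} (\<lambda>u. m * \<phi> u) \<le> integral {0..1} (\<lambda>u. a u * \<phi> u)"
    using assms i by (intro integral_le) (auto intro: mult_right_mono)
  then show "m * integral {0..1} \<phi> \<le> integral {0..1} (\<lambda>u. a u * \<phi> u)" by simp
  have "integral {0..1} (\<lambda>u. a u * \<phi> u) \<le> integral {0..1} (\<lambda>u. M * \<phi> u)"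
    using assms i by (intro integral_le) (auto intro: mult_right_mono)
  then show "integral {0..1} (\<lambda>u. a u * \<phi> u) \<le> M * integral {0..1} \<phi>" by simp
qed

text \<open>Numerator and denominator both lie between m and M times the integral of
  \<open>\<phi>\<close>, and this positive integral cancels.\<close>

lemma weighted_quotient_bounds:
  fixes a b \<phi> :: "real \<Rightarrow> real"
  assumes "continuous_on {0..1} a" "continuous_on {0..1} b" "continuous_on {0..1} \<phi>"
    and "\<And>u. u \<in> {0..1} \<Longrightarrow> m \<le> a u \<and> a u \<le> M" "\<And>u. u \<in> {0..1} \<Longrightarrow> m \<le> b u \<and> b u \<le> M"
    and "\<And>u. u \<in> {0..1} \<Longrightarrow> 0 \<le> \<phi> u" "0 < m" "m \<le> M" "0 < integral {0..1} \<phi>"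
  shows "0 < integral {0..1} (\<lambda>u. b u * \<phi> u)"
    and "m / M \<le> integral {0..1} (\<lambda>u. a u * \<phi> u) / integral {0..1} (\<lambda>u. b u * \<phi> u)"
    and "integral {0..1} (\<lambda>u. a u * \<phi> u) / integral {0..1} (\<lambda>u. b u * \<phi> u) \<le> M / m"
proof -
  let ?I = "integral {0..1} \<phi>"
  note A = weighted_integral_bounds[OF assms(1,3,4,6)]
  note B = weighted_integral_bounds[OF assms(2,3,5,6)]
  have mI: "0 < m * ?I" using assms by simp
  then show pos: "0 < integral {0..1} (\<lambda>u. b u * \<phi> u)" using B by linarith
  have "(m * ?I) / (M * ?I) \<le> integral {0..1} (\<lambda>u. a u * \<phi> u) / integral {0..1} (\<lambda>u. b u * \<phi> u)"
    using A B pos mI by (intro frac_le) auto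
  then show "m / M \<le> integral {0..1} (\<lambda>u. a u * \<phi> u) / integral {0..1} (\<lambda>u. b u * \<phi> u)"
    using assms by simp
  have "integral {0..1} (\<lambda>u. a u * \<phi> u) / integral {0..1} (\<lambda>u. b u * \<phi> u) \<le> (M * ?I) / (m * ?I)"
    using A B pos mI by (intro frac_le) auto
  then show "integral {0..1} (\<lambda>u. a u * \<phi> u) / integral {0..1} (\<lambda>u. b u * \<phi> u) \<le> M / m"
    using assms by simp
qed

text \<open>In the integral formula for the difference, the kernel \<open>a u - v * b u\<close> is
  at most m ((M/m)^2 - 1) in absolute value, while the denominator is at least m c; the factor m
  cancels.\<close>

lemma weighted_quotient_lipschitz:
  fixes a b f g :: "real \<Rightarrow> real"
  assumes "continuous_on {0..1} a" "continuous_on {0..1} b"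
    and "continuous_on {0..1} f" "continuous_on {0..1} g"
    and "\<And>u. u \<in> {0..1} \<Longrightarrow> m \<le> a u \<and> a u \<le> M" "\<And>u. u \<in> {0..1} \<Longrightarrow> m \<le> b u \<and> b u \<le> M"
    and "0 < m" "m \<le> M" "0 < c"
    and "\<And>u. u \<in> {0..1} \<Longrightarrow> c \<le> f u" "\<And>u. u \<in> {0..1} \<Longrightarrow> c \<le> g u"
    and "\<And>u. u \<in> {0..1} \<Longrightarrow> \<bar>f u - g u\<bar> \<le> D"
  shows "\<bar>integral {0..1} (\<lambda>u. a u * g u) / integral {0..1} (\<lambda>u. b u * g u)
          - integral {0..1} (\<lambda>u. a u * f u) / integral {0..1} (\<lambda>u. b u * f u)\<bar>
         \<le> ((M / m)\<^sup>2 - 1) * D / c"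
proof -
  have mean: "c \<le> integral {0..1} \<phi>"
    if "continuous_on {0..1} \<phi>" "\<And>u. u \<in> {0..1} \<Longrightarrow> c \<le> \<phi> u" for \<phi> :: "real \<Rightarrow> real"
    using integral_le[of "\<lambda>_. c" "{0..1}" \<phi>] that
    by (auto intro: integrable_continuous_interval)
  have f0: "0 \<le> f u" and g0: "0 \<le> g u" if "u \<in> {0..1}" for u
    using assms(9) assms(10,11)[OF that] by linarith+
  have cf: "0 < integral {0..1} f" and cg: "c \<le> integral {0..1} g"
    using mean[OF assms(3,10)] mean[OF assms(4,11)] assms(9) by linarith+
  define v where "v = integral {0..1} (\<lambda>u. a u * f u) / integral {0..1} (\<lambda>u. b u * f u)"
  note F = weighted_quotient_bounds[OF assms(1-3,5,6) f0 assms(7,8) cf, folded v_def]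
  define G where "G = integral {0..1} (\<lambda>u. b u * g u)"
  have "m * c \<le> m * integral {0..1} g" using cg assms by simp
  then have G: "m * c \<le> G"
    using weighted_integral_bounds(1)[OF assms(2,4,6) g0] unfolding G_def by linarith
  have mc: "0 < m * c" using assms by simp
  have i: "(\<lambda>u. \<psi> u * \<phi> u) integrable_on {0..1}"
    if "continuous_on {0..1} \<psi>" "continuous_on {0..1} \<phi>" for \<psi> \<phi> :: "real \<Rightarrow> real"
    using that by (intro integrable_continuous_interval continuous_intros)
  have "integral {0..1} (\<lambda>u. (a u - v * b u) * (g u - f u))
      = integral {0..1} (\<lambda>u. (a u * g u - a u * f u) - v * (b u * g u - b u * f u))"
    by (simp add: algebra_simps)
  also have "\<dots> = (integral {0..1} (\<lambda>u. a u * g u) - integral {0..1} (\<lambda>u. a u * f u))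
      - v * (G - integral {0..1} (\<lambda>u. b u * f u))"
    unfolding G_def using i assms(1-4)
    by (simp add: integral_diff integrable_diff integrable_on_mult_right)
  \<comment> \<open>The choice of \<open>v\<close> makes \<open>a u - v * b u\<close> integrate to 0
    against \<open>f\<close>, so both terms in \<open>f\<close> drop out.\<close>
  also have "\<dots> = integral {0..1} (\<lambda>u. a u * g u) - v * G"
    using F(1) by (simp add: v_def field_simps)
  finally have eq: "integral {0..1} (\<lambda>u. a u * g u) / G - v
      = integral {0..1} (\<lambda>u. (a u - v * b u) * (g u - f u)) / G"
    using G mc by (simp add: field_simps)
  \<comment> \<open>Since \<open>v\<close> lies in [m/M, M/m], the kernel lies between m - M^2/m and
    M - m^2/M; the lower end has the larger absolute value and gives the bound.\<close>
  have kernel: "\<bar>a u - v * b u\<bar> \<le> m * ((M / m)\<^sup>2 - 1)" if u: "u \<in> {0..1}" for u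
  proof -
    have v0: "0 \<le> v" using F(2) assms(7,8) by (intro order_trans[OF _ F(2)]) simp
    have "v * b u \<le> (M / m) * M"
      using F(3) assms(6)[OF u] assms(7,8) v0 by (intro mult_mono) auto
    moreover have "(m / M) * m \<le> v * b u"
      using F(2) assms(6)[OF u] assms(7,8) v0 by (intro mult_mono) auto
    \<comment> \<open>The right side is M/m \<ge> 1 times the nonnegative left side, which explains
      the factored difference below.\<close>
    moreover have "M - (m / M) * m \<le> (M / m) * M - m"
    proof -
      have "m * m \<le> M * M" using assms(7,8) by (intro mult_mono) auto
      then have "0 \<le> (M / m - 1) * (M - (m / M) * m)"
        using assms(7,8) by (intro mult_nonneg_nonneg) (auto simp: field_simps)
      also have "\<dots> = ((M / m) * M - m) - (M - (m / M) * m)"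
        using assms(7,8) by (simp add: field_simps)
      finally show ?thesis by simp
    qed
    moreover have "m * ((M / m)\<^sup>2 - 1) = (M / m) * M - m"
      using assms(7) by (simp add: field_simps power2_eq_square)
    ultimately show ?thesis using assms(5)[OF u] by linarith
  qed
  have "0 \<le> D" using assms(12)[of 0] by simp
  have "norm (integral {0..1} (\<lambda>u. (a u - v * b u) * (g u - f u)))
      \<le> m * ((M / m)\<^sup>2 - 1) * D * (1 - 0)"
  proof (rule integral_bound)
    show "continuous_on {0..1} (\<lambda>u. (a u - v * b u) * (g u - f u))"
      using assms(1-4) by (intro continuous_intros)
    fix u :: real assume u: "u \<in> {0..1}"
    have "\<bar>a u - v * b u\<bar> * \<bar>g u - f u\<bar> \<le> m * ((M / m)\<^sup>2 - 1) * D"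
      using kernel[OF u] assms(12)[OF u] \<open>0 \<le> D\<close>
      by (intro mult_mono) (auto simp: abs_minus_commute intro: order_trans[OF abs_ge_zero])
    then show "norm ((a u - v * b u) * (g u - f u)) \<le> m * ((M / m)\<^sup>2 - 1) * D"
      by (simp add: abs_mult)
  qed simp
  then have "\<bar>integral {0..1} (\<lambda>u. (a u - v * b u) * (g u - f u))\<bar> / G
      \<le> (m * ((M / m)\<^sup>2 - 1) * D) / (m * c)"
    using G mc by (intro frac_le) auto
  then show ?thesis
    using eq G mc assms(7) unfolding G_def[symmetric] v_def[symmetric] by simp
qed

text \<open>A continuous nonnegative function with integral 0 vanishes on the interval. This
  supplies the positivity that \<open>weighted_quotient_bounds\<close> asks for, so that no
  denominator in the system is 0.\<close>

lemma integral_pos_C0_plus: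
  assumes "\<phi> \<in> C0_plus"
  shows "0 < integral {0..1} \<phi>"
proof -
  have c: "continuous_on {0..1} \<phi>" and n: "\<And>u. u \<in> {0..1} \<Longrightarrow> 0 \<le> \<phi> u"
    and z: "\<exists>t\<in>{0..1}. \<phi> t \<noteq> 0"
    using assms by (auto simp: C0_plus_def)
  have "integral {0..1} \<phi> \<noteq> 0"
    using integral_cbox_eq_0_iff[of 0 1 \<phi>] c n z by auto
  moreover have "0 \<le> integral {0..1} \<phi>"
    using c n by (intro integral_nonneg integrable_continuous_interval)
  ultimately show ?thesis by simp
qed

theorem theorem5p4:
  fixes k :: nat and K :: "real \<times> real \<Rightarrow> real" and M m :: real
  assumes "k \<ge> 2"
    and "continuous_on ({0..1} \<times> {0..1}) K"
    and "\<forall>p\<in>{0..1} \<times> {0..1}. K p > 0"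
    and "is_max_on K ({0..1} \<times> {0..1}) M"
    and "is_min_on K ({0..1} \<times> {0..1}) m"
    and "(M / m) ^ k - (m / M) ^ k < 1 / real k"
  shows "\<not> (\<exists>f\<in>C0_plus. \<exists>g\<in>C0_plus.
    (\<forall>t\<in>{0..1}.
       f t = (integral {0..1} (\<lambda>u. K (t, u) * g u) / integral {0..1} (\<lambda>u. K (0, u) * g u)) ^ k \<and>
       g t = (integral {0..1} (\<lambda>u. K (t, u) * f u) / integral {0..1} (\<lambda>u. K (0, u) * f u)) ^ k) \<and>
    (\<exists>t\<in>{0..1}. f t \<noteq> g t))"
proof clarify
  fix f g t
  assume fC: "f \<in> C0_plus" and gC: "g \<in> C0_plus"
    and sys: "\<forall>t\<in>{0..1}.
       f t = (integral {0..1} (\<lambda>u. K (t, u) * g u) / integral {0..1} (\<lambda>u. K (0, u) * g u)) ^ k \<and>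
       g t = (integral {0..1} (\<lambda>u. K (t, u) * f u) / integral {0..1} (\<lambda>u. K (0, u) * f u)) ^ k"
    and t: "t \<in> {0..1}" and ne: "f t \<noteq> g t"
  define Q where
    "Q \<phi> t = integral {0..1} (\<lambda>u. K (t, u) * \<phi> u) / integral {0..1} (\<lambda>u. K (0, u) * \<phi> u)" for \<phi> t
  have K: "m \<le> K (t, u) \<and> K (t, u) \<le> M" if "t \<in> {0..1}" "u \<in> {0..1}" for t u
    using assms(4,5) that by (auto simp: is_max_on_def is_min_on_def)
  have m: "0 < m" using assms(3,5) by (auto simp: is_min_on_def)
  have mM: "m \<le> M" using K[of 0 0] by simp
  have Kc: "continuous_on {0..1} (\<lambda>u. K (t, u))" if "t \<in> {0..1}" for t
    by (rule continuous_on_compose2[OF assms(2)]) (use that in \<open>auto intro!: continuous_intros\<close>)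
  have c: "continuous_on {0..1} \<phi>" and n: "\<And>u. u \<in> {0..1} \<Longrightarrow> 0 \<le> \<phi> u"
    if "\<phi> \<in> C0_plus" for \<phi>
    using that by (auto simp: C0_plus_def)
  have Q: "m / M \<le> Q \<phi> t" "Q \<phi> t \<le> M / m" if "\<phi> \<in> C0_plus" "t \<in> {0..1}" for \<phi> t
    unfolding Q_def
    using weighted_quotient_bounds(2,3)[where M = M, OF Kc[OF that(2)] Kc[of 0] c[OF that(1)]
        K[OF that(2)] K[of 0] n[OF that(1)] m mM integral_pos_C0_plus[OF that(1)]]
    by auto
  have fQ: "f t = Q g t ^ k" and gQ: "g t = Q f t ^ k" if "t \<in> {0..1}" for t
    using sys that by (auto simp: Q_def)
  have mM0: "0 < m / M" using m mM by simp
  \<comment> \<open>Membership in \<open>C0_plus\<close> allows zeros; the equations themselves push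
    a solution away from 0. This bound is the constant \<open>c\<close> of the Lipschitz
    estimate.\<close>
  have lower: "(m / M) ^ k \<le> f t" "(m / M) ^ k \<le> g t" if "t \<in> {0..1}" for t
    using Q[OF fC that] Q[OF gC that] mM0 fQ[OF that] gQ[OF that] by (auto intro!: power_mono)
  \<comment> \<open>The sup norm of f - g is attained at some \<open>s\<close>, so it suffices to
    estimate the difference at that one point.\<close>
  have "continuous_on {0..1} (\<lambda>t. \<bar>f t - g t\<bar>)"
    using c[OF fC] c[OF gC] by (intro continuous_intros)
  then obtain s where s: "s \<in> {0..1}" and
    max: "\<And>u. u \<in> {0..1} \<Longrightarrow> \<bar>f u - g u\<bar> \<le> \<bar>f s - g s\<bar>"
    using continuous_attains_sup[of "{0..1::real}" "\<lambda>t. \<bar>f t - g t\<bar>"] by auto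
  define D where "D = \<bar>f s - g s\<bar>"
  have D: "0 < D" using max[OF t] ne by (simp add: D_def)
  have "\<bar>Q g s - Q f s\<bar> \<le> ((M / m)\<^sup>2 - 1) * D / (m / M) ^ k"
    unfolding Q_def
    by (rule weighted_quotient_lipschitz)
      (use Kc s c fC gC K m mM mM0 lower max in \<open>auto simp: D_def\<close>)
  also have "\<dots> = ((M / m)\<^sup>2 - 1) * (M / m) ^ k * D"
    using m mM by (simp add: power_divide)
  finally have *: "\<bar>Q g s - Q f s\<bar> \<le> ((M / m)\<^sup>2 - 1) * (M / m) ^ k * D" .
  \<comment> \<open>The system exchanges the roles of \<open>f\<close> and \<open>g\<close>, but the
    absolute difference is symmetric, so the same norm \<open>D\<close> returns on the
    right.\<close>
  have "D = \<bar>Q g s ^ k - Q f s ^ k\<bar>" using fQ[OF s] gQ[OF s] by (simp add: D_def)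
  also have "\<dots> \<le> real k * (M / m) ^ (k - 1) * \<bar>Q g s - Q f s\<bar>"
    using Q[OF fC s] Q[OF gC s] mM0 by (intro abs_power_diff_le) auto
  also have "\<dots> \<le> real k * (M / m) ^ (k - 1) * (((M / m)\<^sup>2 - 1) * (M / m) ^ k * D)"
    using * m mM by (intro mult_left_mono) auto
  also have "\<dots> = real k * (M / m) ^ (k - 1) * (((M / m)\<^sup>2 - 1) * (M / m) ^ k) * D"
    by (simp add: mult.assoc)
  \<comment> \<open>As \<open>D\<close> is positive, a factor below 1 closes the chain to
    \<open>D < D\<close>.\<close>
  also have "\<dots> < 1 * D"
    using contraction_factor_less_1[of k "M / m"] assms(1,6) m mM D
    by (intro mult_strict_right_mono) auto
  finally show False by simp
qed

end
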